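(* Let $(R_k)_{k\in S}$ be a family of nonzero commutative rings indexed by a set $S$, and let $R=\prod_{k\in S}R_k$. Then every connected component of $\operatorname{Spec}(R)$ is contained in the set of tame primes of $R$ or in the set of wild primes of $R$.
   Context: All rings are commutative with identity; $\operatorname{Spec}(R)$ carries the Zariski topology. For $k\in S$, $\pi_k:R\to R_k$ denotes the projection map. A tame prime of $R=\prod_{k\in S}R_k$ is a prime ideal of $R$ of the form $\pi_k^{-1}(\mathfrak p)$ for some $k\in S$ and some prime ideal $\mathfrak p$ of $R_k$. A wild prime of $R$ is a prime ideal of $R$ which is not tame. *)

theory Defs
  imports "HOL-Algebra.Ideal" "HOL-Analysis.Abstract_Topology_2"
begin

text \<open>As in \<^const>\<open>PiE\<close>, elements of the product are functions equal to
  \<^const>\<open>undefined\<close> outside the index set; for an empty index set this is the zero ring.\<close>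

definition product_ring :: "'i set \<Rightarrow> ('i \<Rightarrow> ('a, 'm) ring_scheme) \<Rightarrow> ('i \<Rightarrow> 'a) ring"
  where "product_ring S R =
    \<lparr>carrier = (\<Pi>\<^sub>E k\<in>S. carrier (R k)),
     monoid.mult = (\<lambda>x y. \<lambda>k\<in>S. x k \<otimes>\<^bsub>R k\<^esub> y k),
     one = (\<lambda>k\<in>S. \<one>\<^bsub>R k\<^esub>),
     zero = (\<lambda>k\<in>S. \<zero>\<^bsub>R k\<^esub>),
     add = (\<lambda>x y. \<lambda>k\<in>S. x k \<oplus>\<^bsub>R k\<^esub> y k)\<rparr>"

lemma product_ring_simps [simp]:
  "carrier (product_ring S R) = (\<Pi>\<^sub>E k\<in>S. carrier (R k))"
  "x \<otimes>\<^bsub>product_ring S R\<^esub> y = (\<lambda>k\<in>S. x k \<otimes>\<^bsub>R k\<^esub> y k)"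
  "\<one>\<^bsub>product_ring S R\<^esub> = (\<lambda>k\<in>S. \<one>\<^bsub>R k\<^esub>)"
  "\<zero>\<^bsub>product_ring S R\<^esub> = (\<lambda>k\<in>S. \<zero>\<^bsub>R k\<^esub>)"
  "x \<oplus>\<^bsub>product_ring S R\<^esub> y = (\<lambda>k\<in>S. x k \<oplus>\<^bsub>R k\<^esub> y k)"
  by (simp_all add: product_ring_def)

lemma cring_product_ring:
  assumes R: "\<And>k. k \<in> S \<Longrightarrow> cring (R k)"
  shows "cring (product_ring S R)"
proof -
  have ring: "ring (R k)" if "k \<in> S" for k
    using R[OF that] by (rule cring.axioms(1))
  have mem: "x k \<in> carrier (R k)" if "x \<in> carrier (product_ring S R)" "k \<in> S" for x k
    using that by auto
  have "abelian_group (product_ring S R)"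
  proof (rule abelian_groupI)
    fix x assume x: "x \<in> carrier (product_ring S R)"
    have "(\<lambda>k\<in>S. \<ominus>\<^bsub>R k\<^esub> x k) \<in> carrier (product_ring S R)"
      using x by (auto intro!: abelian_group.a_inv_closed ring.is_abelian_group ring)
    moreover have "(\<lambda>k\<in>S. \<ominus>\<^bsub>R k\<^esub> x k) \<oplus>\<^bsub>product_ring S R\<^esub> x = \<zero>\<^bsub>product_ring S R\<^esub>"
      using x by (auto intro!: restrict_ext abelian_group.l_neg ring.is_abelian_group ring)
    ultimately show "\<exists>y\<in>carrier (product_ring S R). y \<oplus>\<^bsub>product_ring S R\<^esub> x = \<zero>\<^bsub>product_ring S R\<^esub>"
      by blast
  next
    fix x y z
    assume xyz: "x \<in> carrier (product_ring S R)" "y \<in> carrier (product_ring S R)"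
      "z \<in> carrier (product_ring S R)"
    show "x \<oplus>\<^bsub>product_ring S R\<^esub> y \<oplus>\<^bsub>product_ring S R\<^esub> z =
        x \<oplus>\<^bsub>product_ring S R\<^esub> (y \<oplus>\<^bsub>product_ring S R\<^esub> z)"
      using mem[OF xyz(1)] mem[OF xyz(2)] mem[OF xyz(3)] ring.ring_simprules(7)[OF ring]
      by (auto intro!: restrict_ext)
  next
    fix x y
    assume xy: "x \<in> carrier (product_ring S R)" "y \<in> carrier (product_ring S R)"
    show "x \<oplus>\<^bsub>product_ring S R\<^esub> y = y \<oplus>\<^bsub>product_ring S R\<^esub> x"
      using mem[OF xy(1)] mem[OF xy(2)] ring.ring_simprules(10)[OF ring]
      by (auto intro!: restrict_ext)
    show "x \<oplus>\<^bsub>product_ring S R\<^esub> y \<in> carrier (product_ring S R)"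
      using mem[OF xy(1)] mem[OF xy(2)] ring.ring_simprules(1)[OF ring] by auto
  next
    show "\<zero>\<^bsub>product_ring S R\<^esub> \<in> carrier (product_ring S R)"
      using ring.ring_simprules(2)[OF ring] by auto
  next
    fix x
    assume x: "x \<in> carrier (product_ring S R)"
    have "\<zero>\<^bsub>product_ring S R\<^esub> \<oplus>\<^bsub>product_ring S R\<^esub> x = (\<lambda>k\<in>S. x k)"
      using mem[OF x] ring.ring_simprules(8)[OF ring] by (auto intro!: restrict_ext)
    then show "\<zero>\<^bsub>product_ring S R\<^esub> \<oplus>\<^bsub>product_ring S R\<^esub> x = x"
      using x by simp
  qed
  moreover have "Group.comm_monoid (product_ring S R)"
  proof (rule comm_monoidI)
    fix x y z
    assume xyz: "x \<in> carrier (product_ring S R)" "y \<in> carrier (product_ring S R)"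
      "z \<in> carrier (product_ring S R)"
    show "x \<otimes>\<^bsub>product_ring S R\<^esub> y \<otimes>\<^bsub>product_ring S R\<^esub> z =
        x \<otimes>\<^bsub>product_ring S R\<^esub> (y \<otimes>\<^bsub>product_ring S R\<^esub> z)"
      using mem[OF xyz(1)] mem[OF xyz(2)] mem[OF xyz(3)] monoid.m_assoc[OF ring.is_monoid[OF ring]]
      by (auto intro!: restrict_ext)
  next
    fix x y
    assume xy: "x \<in> carrier (product_ring S R)" "y \<in> carrier (product_ring S R)"
    show "x \<otimes>\<^bsub>product_ring S R\<^esub> y = y \<otimes>\<^bsub>product_ring S R\<^esub> x"
      using mem[OF xy(1)] mem[OF xy(2)] comm_monoid.m_comm[OF cring.axioms(2)[OF R]]
      by (auto intro!: restrict_ext)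
    show "x \<otimes>\<^bsub>product_ring S R\<^esub> y \<in> carrier (product_ring S R)"
      using mem[OF xy(1)] mem[OF xy(2)] monoid.m_closed[OF ring.is_monoid[OF ring]] by auto
  next
    show "\<one>\<^bsub>product_ring S R\<^esub> \<in> carrier (product_ring S R)"
      using monoid.one_closed[OF ring.is_monoid[OF ring]] by auto
  next
    fix x
    assume x: "x \<in> carrier (product_ring S R)"
    have "\<one>\<^bsub>product_ring S R\<^esub> \<otimes>\<^bsub>product_ring S R\<^esub> x = (\<lambda>k\<in>S. x k)"
      using mem[OF x] monoid.l_one[OF ring.is_monoid[OF ring]] by (auto intro!: restrict_ext)
    then show "\<one>\<^bsub>product_ring S R\<^esub> \<otimes>\<^bsub>product_ring S R\<^esub> x = x"
      using x by simp
  qed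
  moreover have "(x \<oplus>\<^bsub>product_ring S R\<^esub> y) \<otimes>\<^bsub>product_ring S R\<^esub> z =
      x \<otimes>\<^bsub>product_ring S R\<^esub> z \<oplus>\<^bsub>product_ring S R\<^esub> y \<otimes>\<^bsub>product_ring S R\<^esub> z"
    if "x \<in> carrier (product_ring S R)" "y \<in> carrier (product_ring S R)"
      "z \<in> carrier (product_ring S R)" for x y z
    using mem[OF that(1)] mem[OF that(2)] mem[OF that(3)] ring.ring_simprules(13)[OF ring]
    by (auto intro!: restrict_ext)
  ultimately show ?thesis by (rule cringI)
qed

definition ring_spectrum :: "('a, 'm) ring_scheme \<Rightarrow> 'a set set"
  where "ring_spectrum A = {P. primeideal P A}"

definition vanishing_set :: "('a, 'm) ring_scheme \<Rightarrow> 'a set \<Rightarrow> 'a set set"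
  where "vanishing_set A E = {P \<in> ring_spectrum A. E \<subseteq> P}"

definition zariski_topology :: "('a, 'm) ring_scheme \<Rightarrow> 'a set topology"
  where "zariski_topology A =
    topology (\<lambda>U. \<exists>E\<subseteq>carrier A. U = ring_spectrum A - vanishing_set A E)"

lemma istopology_zariski:
  "istopology (\<lambda>U. \<exists>E\<subseteq>carrier A. U = ring_spectrum A - vanishing_set A E)"
  unfolding istopology_def
proof (intro conjI allI impI)
  fix U V
  assume "\<exists>E\<subseteq>carrier A. U = ring_spectrum A - vanishing_set A E"
    and "\<exists>E\<subseteq>carrier A. V = ring_spectrum A - vanishing_set A E"
  then obtain E F where E: "E \<subseteq> carrier A" "U = ring_spectrum A - vanishing_set A E"
    and F: "F \<subseteq> carrier A" "V = ring_spectrum A - vanishing_set A F" by blast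
  define G where "G = {x \<otimes>\<^bsub>A\<^esub> y |x y. x \<in> E \<and> y \<in> F}"
  have *: "G \<subseteq> P \<longleftrightarrow> E \<subseteq> P \<or> F \<subseteq> P" if "primeideal P A" for P
  proof -
    interpret primeideal P A by fact
    show ?thesis
    proof
      assume G: "G \<subseteq> P"
      show "E \<subseteq> P \<or> F \<subseteq> P"
      proof (rule ccontr)
        assume "\<not> (E \<subseteq> P \<or> F \<subseteq> P)"
        then obtain x y where xy: "x \<in> E" "x \<notin> P" "y \<in> F" "y \<notin> P" by blast
        then have "x \<otimes>\<^bsub>A\<^esub> y \<in> P" using G unfolding G_def by blast
        moreover have "x \<in> carrier A" "y \<in> carrier A" using xy E(1) F(1) by auto
        ultimately show False using I_prime xy by blast
      qed
    next
      assume EF: "E \<subseteq> P \<or> F \<subseteq> P"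
      have "x \<otimes>\<^bsub>A\<^esub> y \<in> P" if "x \<in> E" "y \<in> F" for x y
      proof -
        have "x \<in> carrier A" "y \<in> carrier A" using that E(1) F(1) by auto
        then show ?thesis using EF that I_l_closed I_r_closed by (meson subsetD)
      qed
      then show "G \<subseteq> P" unfolding G_def by blast
    qed
  qed
  show "\<exists>E\<subseteq>carrier A. U \<inter> V = ring_spectrum A - vanishing_set A E"
  proof (cases "ring_spectrum A = {}")
    case True
    then show ?thesis using E by auto
  next
    case False
    then obtain P where "primeideal P A" by (auto simp: ring_spectrum_def)
    then interpret primeideal P A .
    have "G \<subseteq> carrier A" using E(1) F(1) by (auto simp: G_def)
    moreover have "U \<inter> V = ring_spectrum A - vanishing_set A G"
      using * by (auto simp: E(2) F(2) vanishing_set_def ring_spectrum_def)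
    ultimately show ?thesis by blast
  qed
next
  fix K
  assume "\<forall>U\<in>K. \<exists>E\<subseteq>carrier A. U = ring_spectrum A - vanishing_set A E"
  then obtain e where e: "\<And>U. U \<in> K \<Longrightarrow> e U \<subseteq> carrier A"
    "\<And>U. U \<in> K \<Longrightarrow> U = ring_spectrum A - vanishing_set A (e U)" by metis
  have "P \<in> \<Union>K \<longleftrightarrow> P \<in> ring_spectrum A - vanishing_set A (\<Union>(e ` K))" for P
  proof -
    have "P \<in> \<Union>K \<longleftrightarrow> (\<exists>U\<in>K. P \<in> ring_spectrum A - vanishing_set A (e U))"
      using e(2) by blast
    then show ?thesis by (auto simp: vanishing_set_def)
  qed
  then have "\<Union>K = ring_spectrum A - vanishing_set A (\<Union>(e ` K))" by blast
  moreover have "\<Union>(e ` K) \<subseteq> carrier A" using e(1) by blast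
  ultimately show "\<exists>E\<subseteq>carrier A. \<Union>K = ring_spectrum A - vanishing_set A E" by blast
qed

lemma openin_zariski:
  "openin (zariski_topology A) U \<longleftrightarrow>
    (\<exists>E\<subseteq>carrier A. U = ring_spectrum A - vanishing_set A E)"
  unfolding zariski_topology_def by (simp only: topology_inverse'[OF istopology_zariski])

lemma topspace_zariski [simp]: "topspace (zariski_topology A) = ring_spectrum A"
proof
  show "topspace (zariski_topology A) \<subseteq> ring_spectrum A"
    unfolding topspace_def openin_zariski by blast
  have "vanishing_set A (carrier A) = {}"
  proof -
    have False if "primeideal P A" "carrier A \<subseteq> P" for P
    proof -
      interpret primeideal P A by fact
      show False using that(2) I_notcarr a_subset by blast
    qed
    then show ?thesis by (auto simp: vanishing_set_def ring_spectrum_def)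
  qed
  then have "openin (zariski_topology A) (ring_spectrum A)"
    unfolding openin_zariski by (intro exI[of _ "carrier A"]) simp
  then show "ring_spectrum A \<subseteq> topspace (zariski_topology A)"
    by (rule openin_subset)
qed

definition tame_primes :: "'i set \<Rightarrow> ('i \<Rightarrow> ('a, 'm) ring_scheme) \<Rightarrow> ('i \<Rightarrow> 'a) set set"
  where "tame_primes S R =
    {P. primeideal P (product_ring S R) \<and>
        (\<exists>k\<in>S. \<exists>p. primeideal p (R k) \<and> P = {x \<in> carrier (product_ring S R). x k \<in> p})}"

definition wild_primes :: "'i set \<Rightarrow> ('i \<Rightarrow> ('a, 'm) ring_scheme) \<Rightarrow> ('i \<Rightarrow> 'a) set set"
  where "wild_primes S R = {P. primeideal P (product_ring S R) \<and> P \<notin> tame_primes S R}"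

end

theory Submission
  imports Defs "HOL-Analysis.Abstract_Topological_Spaces"
begin

text \<open>Let \<open>e\<^sub>k\<close> be the element of the product that is \<open>1\<close> at \<open>k\<close> and \<open>0\<close> elsewhere. As \<open>e\<^sub>k\<close> is
  idempotent, the primes not containing it form a clopen set. These primes are exactly the tame
  primes arising from the factor \<open>R\<^sub>k\<close>, so a component that contains one of them consists of them.\<close>

text \<open>A prime contains the product 0, hence \<open>e\<close> or \<open>f\<close>; it cannot
  contain both, because their sum is 1. So the basic open sets of \<open>e\<close> and
  \<open>f\<close> are complementary, and each is closed as well as open. The two equations say
  precisely that \<open>e\<close> is idempotent and \<open>f\<close> is 1 -
  \<open>e\<close>.\<close>

lemma clopen_complementary_idempotents:
  assumes "cring A" and e: "e \<in> carrier A" and f: "f \<in> carrier A"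
    and sum: "e \<oplus>\<^bsub>A\<^esub> f = \<one>\<^bsub>A\<^esub>" and prod: "e \<otimes>\<^bsub>A\<^esub> f = \<zero>\<^bsub>A\<^esub>"
  shows "closedin (zariski_topology A) {P \<in> ring_spectrum A. e \<notin> P}"
    and "openin (zariski_topology A) {P \<in> ring_spectrum A. e \<notin> P}"
proof -
  have basic_open: "openin (zariski_topology A) {P \<in> ring_spectrum A. x \<notin> P}"
    if "x \<in> carrier A" for x
    unfolding openin_zariski using that
    by (intro exI[of _ "{x}"]) (auto simp: vanishing_set_def)
  then show "openin (zariski_topology A) {P \<in> ring_spectrum A. e \<notin> P}"
    using e .
  have "e \<in> P \<longleftrightarrow> f \<notin> P" if "primeideal P A" for P
  proof -
    interpret primeideal P A by fact
    show ?thesis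
      using I_prime[OF e f] prod sum one_imp_carrier I_notcarr
      by (metis additive_subgroup.zero_closed additive_subgroup.a_closed is_additive_subgroup)
  qed
  then have "ring_spectrum A - {P \<in> ring_spectrum A. e \<notin> P} = {P \<in> ring_spectrum A. f \<notin> P}"
    by (auto simp: ring_spectrum_def)
  then show "closedin (zariski_topology A) {P \<in> ring_spectrum A. e \<notin> P}"
    using basic_open[OF f] by (simp add: closedin_def)
qed

text \<open>For \<open>k\<close> in \<open>S\<close> this is the embedding of the factor at
  \<open>k\<close> into the product: a section of the projection that respects sums and products but
  in general not the identity. Its value at 1 is the idempotent \<open>e\<^sub>k\<close>.\<close>

definition product_single :: "'i set \<Rightarrow> ('i \<Rightarrow> ('a, 'm) ring_scheme) \<Rightarrow> 'i \<Rightarrow> 'a \<Rightarrow> 'i \<Rightarrow> 'a"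
  where "product_single S R k a = (\<lambda>j\<in>S. if j = k then a else \<zero>\<^bsub>R j\<^esub>)"

context
  fixes S :: "'i set" and R :: "'i \<Rightarrow> ('a, 'm) ring_scheme" and k :: 'i
  assumes cring: "\<And>j. j \<in> S \<Longrightarrow> cring (R j)" and k: "k \<in> S"
begin

lemma ring_factor: "j \<in> S \<Longrightarrow> ring (R j)"
  using cring by (rule cring.axioms(1))

lemma product_single_closed:
  "a \<in> carrier (R k) \<Longrightarrow> product_single S R k a \<in> carrier (product_ring S R)"
  using ring.ring_simprules(2)[OF ring_factor] by (auto simp: product_single_def)

lemma product_single_add:
  "product_single S R k (a \<oplus>\<^bsub>R k\<^esub> b) =
    product_single S R k a \<oplus>\<^bsub>product_ring S R\<^esub> product_single S R k b"
  using ring.ring_simprules(8)[OF ring_factor] ring.ring_simprules(2)[OF ring_factor]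
  by (auto simp: product_single_def intro!: restrict_ext)

text \<open>Away from \<open>k\<close> the entries of \<open>x\<close> are multiplied by 0, so only
  \<open>x k\<close> matters. Taking \<open>a\<close> to be 1 shows that multiplication by
  \<open>e\<^sub>k\<close> projects to the factor at \<open>k\<close> and embeds back; taking
  \<open>x\<close> in the image of the embedding gives multiplicativity.\<close>

lemma product_single_mult:
  assumes "a \<in> carrier (R k)" "x \<in> carrier (product_ring S R)"
  shows "product_single S R k (a \<otimes>\<^bsub>R k\<^esub> x k) =
    product_single S R k a \<otimes>\<^bsub>product_ring S R\<^esub> x"
  using assms ring.ring_simprules(24)[OF ring_factor]
  by (auto simp: product_single_def PiE_iff intro!: restrict_ext)

lemma product_single_at: "product_single S R k a k = a"
  using k by (simp add: product_single_def)

lemma clopen_product_single: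
  defines "U \<equiv> {P \<in> ring_spectrum (product_ring S R). product_single S R k \<one>\<^bsub>R k\<^esub> \<notin> P}"
  shows "closedin (zariski_topology (product_ring S R)) U"
    and "openin (zariski_topology (product_ring S R)) U"
proof -
  \<comment> \<open>The complementary idempotent 1 - \<open>e\<^sub>k\<close>, written out
    entrywise.\<close>
  define f where "f = (\<lambda>j\<in>S. if j = k then \<zero>\<^bsub>R j\<^esub> else \<one>\<^bsub>R j\<^esub>)"
  note rules = ring.ring_simprules(2,6,8,15,24,25)[OF ring_factor]
  have e: "product_single S R k \<one>\<^bsub>R k\<^esub> \<in> carrier (product_ring S R)"
    using product_single_closed rules k by simp
  have f: "f \<in> carrier (product_ring S R)"
    using rules by (auto simp: f_def)
  have sum: "product_single S R k \<one>\<^bsub>R k\<^esub> \<oplus>\<^bsub>product_ring S R\<^esub> f = \<one>\<^bsub>product_ring S R\<^esub>"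
    using rules by (auto simp: f_def product_single_def intro!: restrict_ext)
  have prod: "product_single S R k \<one>\<^bsub>R k\<^esub> \<otimes>\<^bsub>product_ring S R\<^esub> f = \<zero>\<^bsub>product_ring S R\<^esub>"
    using rules by (auto simp: f_def product_single_def intro!: restrict_ext)
  show "closedin (zariski_topology (product_ring S R)) U"
    and "openin (zariski_topology (product_ring S R)) U"
    unfolding U_def
    using clopen_complementary_idempotents[OF cring_product_ring e f sum prod] cring by blast+
qed

text \<open>The entry of \<open>e\<^sub>k\<close> at \<open>k\<close> is 1, which lies in no prime
  of the factor. Conversely, if \<open>e\<^sub>k\<close> is outside \<open>P\<close>, then
  membership of \<open>x\<close> in \<open>P\<close> is the same as that of \<open>e\<^sub>k\<close>
  times \<open>x\<close>, which depends on \<open>x k\<close> alone.\<close>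

lemma tame_at_iff:
  assumes "primeideal P (product_ring S R)"
  shows "(\<exists>p. primeideal p (R k) \<and> P = {x \<in> carrier (product_ring S R). x k \<in> p}) \<longleftrightarrow>
    product_single S R k \<one>\<^bsub>R k\<^esub> \<notin> P"
proof
  assume "\<exists>p. primeideal p (R k) \<and> P = {x \<in> carrier (product_ring S R). x k \<in> p}"
  then obtain p where p: "primeideal p (R k)" "P = {x \<in> carrier (product_ring S R). x k \<in> p}"
    by blast
  interpret p: primeideal p "R k" by (rule p)
  have "\<one>\<^bsub>R k\<^esub> \<notin> p"
    using p.one_imp_carrier p.I_notcarr by metis
  then show "product_single S R k \<one>\<^bsub>R k\<^esub> \<notin> P"
    using p(2) by (simp add: product_single_at)
next
  assume e: "product_single S R k \<one>\<^bsub>R k\<^esub> \<notin> P"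
  interpret P: primeideal P "product_ring S R" by fact
  interpret Rk: cring "R k" by (rule cring[OF k])
  let ?A = "product_ring S R" and ?s = "product_single S R k"
  \<comment> \<open>The contraction of \<open>P\<close> along the embedding. It is the only
    candidate: since \<open>?s a\<close> has entry \<open>a\<close> at \<open>k\<close>, a prime
    whose preimage is \<open>P\<close> must contain \<open>a\<close> exactly when
    \<open>?s a\<close> is in \<open>P\<close>.\<close>
  define p where "p = {a \<in> carrier (R k). ?s a \<in> P}"
  have s_mult: "?s (a \<otimes>\<^bsub>R k\<^esub> b) = ?s a \<otimes>\<^bsub>?A\<^esub> ?s b"
    if "a \<in> carrier (R k)" "b \<in> carrier (R k)" for a b
    using product_single_mult[OF that(1) product_single_closed[OF that(2)]]
    by (simp only: product_single_at)
  have mult_p: "x \<otimes>\<^bsub>R k\<^esub> a \<in> p" if "a \<in> p" "x \<in> carrier (R k)" for a x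
  proof -
    have a: "a \<in> carrier (R k)" "?s a \<in> P"
      using that(1) by (auto simp: p_def)
    have "?s (x \<otimes>\<^bsub>R k\<^esub> a) \<in> P"
      unfolding s_mult[OF that(2) a(1)]
      by (rule P.I_l_closed[OF a(2) product_single_closed[OF that(2)]])
    then show ?thesis
      using a(1) that(2) by (simp add: p_def)
  qed
  have add_p: "a \<oplus>\<^bsub>R k\<^esub> b \<in> p" if "a \<in> p" "b \<in> p" for a b
  proof -
    have ab: "a \<in> carrier (R k)" "?s a \<in> P" "b \<in> carrier (R k)" "?s b \<in> P"
      using that by (auto simp: p_def)
    have "?s (a \<oplus>\<^bsub>R k\<^esub> b) \<in> P"
      unfolding product_single_add
      by (rule additive_subgroup.a_closed[OF P.is_additive_subgroup ab(2,4)])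
    then show ?thesis
      using ab by (simp add: p_def)
  qed
  have "?s \<zero>\<^bsub>R k\<^esub> = \<zero>\<^bsub>?A\<^esub>"
    by (auto simp: product_single_def intro!: restrict_ext)
  then have zero_p: "\<zero>\<^bsub>R k\<^esub> \<in> p"
    using additive_subgroup.zero_closed[OF P.is_additive_subgroup] by (simp add: p_def)
  have "ideal p (R k)"
  proof (rule idealI)
    show "subgroup p (add_monoid (R k))"
    proof (rule Rk.add.subgroupI)
      fix a assume a: "a \<in> p"
      \<comment> \<open>Absorption is already available, so closure under negation reduces to
        multiplication by -1.\<close>
      then have "\<ominus>\<^bsub>R k\<^esub> a = (\<ominus>\<^bsub>R k\<^esub> \<one>\<^bsub>R k\<^esub>) \<otimes>\<^bsub>R k\<^esub> a"
        by (simp add: p_def Rk.l_minus)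
      then show "\<ominus>\<^bsub>R k\<^esub> a \<in> p"
        using mult_p[OF a, of "\<ominus>\<^bsub>R k\<^esub> \<one>\<^bsub>R k\<^esub>"] by simp
    qed (use zero_p add_p in \<open>auto simp: p_def\<close>)
    show "a \<otimes>\<^bsub>R k\<^esub> x \<in> p" if "a \<in> p" "x \<in> carrier (R k)" for a x
      using mult_p[OF that] that by (simp add: p_def Rk.m_comm)
  qed (use mult_p Rk.ring_axioms in auto)
  \<comment> \<open>Properness comes from the assumption on \<open>e\<^sub>k\<close>: it says that 1
    is not in \<open>p\<close>.\<close>
  moreover have "carrier (R k) \<noteq> p"
    using e Rk.one_closed by (auto simp: p_def)
  moreover have "a \<in> p \<or> b \<in> p"
    if "a \<in> carrier (R k)" "b \<in> carrier (R k)" "a \<otimes>\<^bsub>R k\<^esub> b \<in> p" for a b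
    using that(3) P.I_prime[OF product_single_closed[OF that(1)] product_single_closed[OF that(2)]]
    by (simp only: p_def mem_Collect_eq s_mult[OF that(1,2)] that(1,2) simp_thms)
  ultimately have "primeideal p (R k)"
    by (intro primeidealI Rk.is_cring)
  moreover have "x \<in> P \<longleftrightarrow> x k \<in> p" if x: "x \<in> carrier ?A" for x
  proof -
    have xk: "x k \<in> carrier (R k)"
      using x k by auto
    have ex: "?s (x k) = ?s \<one>\<^bsub>R k\<^esub> \<otimes>\<^bsub>?A\<^esub> x"
      using product_single_mult[OF Rk.one_closed x] xk by simp
    \<comment> \<open>Primality cancels the factor \<open>e\<^sub>k\<close>, which is outside
      \<open>P\<close>; the converse is absorption.\<close>
    have "?s \<one>\<^bsub>R k\<^esub> \<otimes>\<^bsub>?A\<^esub> x \<in> P \<longleftrightarrow> x \<in> P"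
      using P.I_prime[OF product_single_closed[OF Rk.one_closed] x] e
        P.I_l_closed[OF _ product_single_closed[OF Rk.one_closed]] by blast
    then show ?thesis
      using ex xk by (simp only: p_def mem_Collect_eq simp_thms)
  qed
  then have "P = {x \<in> carrier ?A. x k \<in> p}"
    using P.a_subset by blast
  ultimately show "\<exists>p. primeideal p (R k) \<and> P = {x \<in> carrier ?A. x k \<in> p}"
    by blast
qed

end

theorem lemma3p3:
  fixes S :: "'i set" and R :: "'i \<Rightarrow> ('a, 'm) ring_scheme"
  assumes "\<And>k. k \<in> S \<Longrightarrow> cring (R k)"
    and "\<And>k. k \<in> S \<Longrightarrow> carrier (R k) \<noteq> {\<zero>\<^bsub>R k\<^esub>}"
  shows "\<forall>C \<in> connected_components_of (zariski_topology (product_ring S R)).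
           C \<subseteq> tame_primes S R \<or> C \<subseteq> wild_primes S R"
proof
  let ?A = "product_ring S R"
  fix C assume C: "C \<in> connected_components_of (zariski_topology ?A)"
  have spec: "C \<subseteq> ring_spectrum ?A"
    using connected_components_of_subset[OF C] by simp
  show "C \<subseteq> tame_primes S R \<or> C \<subseteq> wild_primes S R"
  proof (cases "C \<inter> tame_primes S R = {}")
    case True
    \<comment> \<open>Points of \<open>C\<close> are primes, and a prime that is not tame is wild by
      definition.\<close>
    then show ?thesis
      using spec by (auto simp: wild_primes_def ring_spectrum_def)
  next
    case False
    then obtain P k where P: "P \<in> C" "primeideal P ?A" and k: "k \<in> S"
      and tame: "\<exists>p. primeideal p (R k) \<and> P = {x \<in> carrier ?A. x k \<in> p}"
      unfolding tame_primes_def by blast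
    \<comment> \<open>The index \<open>k\<close> is the one at which the chosen point
      \<open>P\<close> of \<open>C\<close> is tame; \<open>U\<close> collects all primes that are
      tame at this same index.\<close>
    define U where "U = {Q \<in> ring_spectrum ?A. product_single S R k \<one>\<^bsub>R k\<^esub> \<notin> Q}"
    have iff: "(\<exists>p. primeideal p (R k) \<and> Q = {x \<in> carrier ?A. x k \<in> p}) \<longleftrightarrow> Q \<in> U"
      if "primeideal Q ?A" for Q
      using tame_at_iff[where R = R and S = S and k = k and P = Q, OF assms(1) k that] that
      by (simp add: U_def ring_spectrum_def)
    \<comment> \<open>A connected set cannot be split by a clopen set, and \<open>P\<close> will
      exclude disjointness.\<close>
    have "C \<subseteq> U \<or> disjnt C U"
      using connectedin_clopen_cases[OF connectedin_connected_components_of[OF C]]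
        clopen_product_single[where R = R and S = S and k = k, OF assms(1) k]
      unfolding U_def by blast
    moreover have "P \<in> U"
      using iff[OF P(2)] tame by blast
    ultimately have "C \<subseteq> U"
      using P(1) by (auto simp: disjnt_iff)
    moreover have "Q \<in> tame_primes S R" if "Q \<in> U" for Q
    proof -
      have "primeideal Q ?A"
        using that by (simp add: U_def ring_spectrum_def)
      with iff[OF this] that k show ?thesis
        unfolding tame_primes_def by blast
    qed
    ultimately show ?thesis
      by blast
  qed
qed

end
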